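(* Let $\mathbb{K}$ be a semiring and $f\colon\mathbb{N}^d\to\mathbb{K}$. If $f$ is $\boldsymbol{\mathcal{S}}$-automatic then $\ker_{\boldsymbol{\mathcal{S}}}(f)$ is finite. If each $L_i$ ($1\le i\le d$) is prefix-closed and $\ker_{\boldsymbol{\mathcal{S}}}(f)$ is finite, then $f$ is $\boldsymbol{\mathcal{S}}$-automatic.
   Context: An abstract numeration system is a triple $\mathcal{S}=(L,A,<)$ where $L$ is an infinite regular language over a finite alphabet $A$ totally ordered by $<$. Words are ordered by the radix order ($u<_{\rm rad}v$ iff $|u|<|v|$, or $|u|=|v|$ and $u$ is lexicographically smaller); $\mathrm{rep}_{\mathcal{S}}\colon\mathbb{N}\to L$ maps $n$ to the $n$-th word of $L$ (indexing from $0$) and $\mathrm{val}_{\mathcal{S}}$ is its inverse. Fix $d\ge1$, abstract numeration systems $\mathcal{S}_i=(L_i,A_i,<_i)$ for $i\in\{1,\dots,d\}$, $\boldsymbol{\mathcal{S}}=(\mathcal{S}_1,\dots,\mathcal{S}_d)$, and a symbol $\#\notin A_1\cup\dots\cup A_d$. Let $\boldsymbol{\#}=(\#,\dots,\#)$ and $\boldsymbol{A}=\big((A_1\cup\{\#\})\times\cdots\times(A_d\cup\{\#\})\big)\setminus\{\boldsymbol{\#}\}$. For words $w_1,\dots,w_d$, $(w_1,\dots,w_d)^\#$ is the word over $\boldsymbol{A}$ obtained by left-padding each $w_i$ with $\#$'s to the maximal length and reading them in parallel. Let $\boldsymbol{L}=\{(w_1,\dots,w_d)^\#: w_i\in L_i\}$,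 $\mathrm{rep}_{\boldsymbol{\mathcal{S}}}(n_1,\dots,n_d)=(\mathrm{rep}_{\mathcal{S}_1}(n_1),\dots,\mathrm{rep}_{\mathcal{S}_d}(n_d))^\#$ (a bijection $\mathbb{N}^d\to\boldsymbol{L}$), $\mathrm{val}_{\boldsymbol{\mathcal{S}}}$ its inverse. A sequence $f\colon\mathbb{N}^d\to\mathbb{K}$ is $\boldsymbol{\mathcal{S}}$-automatic if there is a deterministic finite automaton with output $(Q,q_0,\delta,\boldsymbol{A},\tau,\Delta)$ with finite output alphabet $\Delta\subseteq\mathbb{K}$ such that $f(\boldsymbol{n})=\tau(\delta(q_0,\mathrm{rep}_{\boldsymbol{\mathcal{S}}}(\boldsymbol{n})))$ for all $\boldsymbol{n}\in\mathbb{N}^d$. For $\boldsymbol{w}\in\boldsymbol{A}^*$, $(f\circ\boldsymbol{w})(\boldsymbol{n})=f(\mathrm{val}_{\boldsymbol{\mathcal{S}}}(\mathrm{rep}_{\boldsymbol{\mathcal{S}}}(\boldsymbol{n})\boldsymbol{w}))$ if the concatenation $\mathrm{rep}_{\boldsymbol{\mathcal{S}}}(\boldsymbol{n})\boldsymbol{w}$ lies in $\boldsymbol{L}$, and $0$ otherwise; the $\boldsymbol{\mathcal{S}}$-kernel of $f$ is $\ker_{\boldsymbol{\mathcal{S}}}(f)=\{f\circ\boldsymbol{w}:\boldsymbol{w}\in\boldsymbol{A}^*\}$. *)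

theory Defs
  imports "HOL-Library.Sublist"
begin

text \<open>Deterministic automata over an explicit input alphabet, with total transition function.
  The behaviour of \<open>dtrans\<close> outside \<open>states \<times> alphabet\<close> is irrelevant.\<close>

record ('q, 'a) det_automaton =
  states :: "'q set"
  initial :: 'q
  dtrans :: "'q \<Rightarrow> 'a \<Rightarrow> 'q"

definition finite_automaton :: "'a set \<Rightarrow> ('q, 'a) det_automaton \<Rightarrow> bool" where
  "finite_automaton A M \<longleftrightarrow>
     finite (states M) \<and> initial M \<in> states M \<and>
     (\<forall>q\<in>states M. \<forall>a\<in>A. dtrans M q a \<in> states M)"

definition run :: "('q, 'a) det_automaton \<Rightarrow> 'a list \<Rightarrow> 'q" where
  "run M w = foldl (dtrans M) (initial M) w"

text \<open>HOL cannot quantify existentially over the type of states.  Taking \<open>nat\<close> as the type of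
  states loses no generality, since state sets are finite.\<close>

definition regular_language :: "'a set \<Rightarrow> 'a list set \<Rightarrow> bool" where
  "regular_language A L \<longleftrightarrow> L \<subseteq> lists A \<and>
     (\<exists>(M :: (nat, 'a) det_automaton) F. finite_automaton A M \<and> F \<subseteq> states M \<and>
        (\<forall>w\<in>lists A. w \<in> L \<longleftrightarrow> run M w \<in> F))"

definition prefix_closed :: "'a list set \<Rightarrow> bool" where
  "prefix_closed L \<longleftrightarrow> (\<forall>w\<in>L. \<forall>u. prefix u w \<longrightarrow> u \<in> L)"

record 'a numeration =
  language :: "'a list set"
  alphabet :: "'a set"
  letter_less :: "('a \<times> 'a) set"

definition abstract_numeration_system :: "'a numeration \<Rightarrow> bool" where
  "abstract_numeration_system S \<longleftrightarrow>
     finite (alphabet S) \<and>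
     letter_less S \<subseteq> alphabet S \<times> alphabet S \<and>
     strict_linear_order_on (alphabet S) (letter_less S) \<and>
     regular_language (alphabet S) (language S) \<and>
     infinite (language S)"

text \<open>The radix order is the library's \<^const>\<open>lenlex\<close>.  The \<open>n\<close>-th word of the language, counting
  from \<open>0\<close>, is the one with exactly \<open>n\<close> predecessors in the language.\<close>

definition rep :: "'a numeration \<Rightarrow> nat \<Rightarrow> 'a list" where
  "rep S n = (THE w. w \<in> language S \<and>
     card {u \<in> language S. (u, w) \<in> lenlex (letter_less S)} = n)"

text \<open>The index set \<open>{1, \<dots>, d}\<close> is a finite type \<open>'d\<close>; since types are nonempty, \<open>d \<ge> 1\<close>.
  All alphabets are subsets of one type \<open>'a\<close>, which also contains the padding symbol \<open>h\<close>.
  A letter of the product alphabet is a function \<open>'d \<Rightarrow> 'a\<close>.\<close>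

definition product_alphabet ::
  "'a \<Rightarrow> ('d::finite \<Rightarrow> 'a numeration) \<Rightarrow> ('d \<Rightarrow> 'a) set" where
  "product_alphabet h S = {a. \<forall>i. a i \<in> alphabet (S i) \<union> {h}} - {\<lambda>_. h}"

definition padded_words :: "'a \<Rightarrow> ('d::finite \<Rightarrow> 'a list) \<Rightarrow> ('d \<Rightarrow> 'a) list" where
  "padded_words h ws =
     (let m = Max (range (\<lambda>i. length (ws i)))
      in map (\<lambda>j i. (replicate (m - length (ws i)) h @ ws i) ! j) [0..<m])"

definition product_language ::
  "'a \<Rightarrow> ('d::finite \<Rightarrow> 'a numeration) \<Rightarrow> ('d \<Rightarrow> 'a) list set" where
  "product_language h S = {padded_words h ws | ws. \<forall>i. ws i \<in> language (S i)}"

definition product_rep ::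
  "'a \<Rightarrow> ('d::finite \<Rightarrow> 'a numeration) \<Rightarrow> ('d \<Rightarrow> nat) \<Rightarrow> ('d \<Rightarrow> 'a) list" where
  "product_rep h S n = padded_words h (\<lambda>i. rep (S i) (n i))"

text \<open>\<open>product_rep h S\<close> is a bijection onto \<open>product_language h S\<close>; the values of \<open>product_val h S\<close>
  outside that language are irrelevant.\<close>

definition product_val ::
  "'a \<Rightarrow> ('d::finite \<Rightarrow> 'a numeration) \<Rightarrow> ('d \<Rightarrow> 'a) list \<Rightarrow> ('d \<Rightarrow> nat)" where
  "product_val h S = inv (product_rep h S)"

definition automatic ::
  "'a \<Rightarrow> ('d::finite \<Rightarrow> 'a numeration) \<Rightarrow> (('d \<Rightarrow> nat) \<Rightarrow> 'k) \<Rightarrow> bool" where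
  "automatic h S f \<longleftrightarrow>
     (\<exists>(M :: (nat, 'd \<Rightarrow> 'a) det_automaton) (\<Delta> :: 'k set) (\<tau> :: nat \<Rightarrow> 'k).
        finite_automaton (product_alphabet h S) M \<and>
        finite \<Delta> \<and> (\<forall>q\<in>states M. \<tau> q \<in> \<Delta>) \<and>
        (\<forall>n. f n = \<tau> (run M (product_rep h S n))))"

definition kernel_elem ::
  "'a \<Rightarrow> ('d::finite \<Rightarrow> 'a numeration) \<Rightarrow> (('d \<Rightarrow> nat) \<Rightarrow> 'k::zero) \<Rightarrow> ('d \<Rightarrow> 'a) list \<Rightarrow>
     ('d \<Rightarrow> nat) \<Rightarrow> 'k" where
  "kernel_elem h S f w n =
     (if product_rep h S n @ w \<in> product_language h S
      then f (product_val h S (product_rep h S n @ w)) else 0)"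

definition numeration_kernel ::
  "'a \<Rightarrow> ('d::finite \<Rightarrow> 'a numeration) \<Rightarrow> (('d \<Rightarrow> nat) \<Rightarrow> 'k::zero) \<Rightarrow>
     (('d \<Rightarrow> nat) \<Rightarrow> 'k) set" where
  "numeration_kernel h S f = kernel_elem h S f ` lists (product_alphabet h S)"

end

theory Submission
  imports Defs "HOL-Library.FuncSet"
begin

text \<open>Every \<open>f \<circ> w\<close> is determined by how right concatenation of \<open>w\<close> acts on the
  automaton of \<open>f\<close> and on the automata of the component languages, which leaves only finitely many
  possibilities.  Conversely, prefix-closedness gives \<open>(f \<circ> w) \<circ> a = f \<circ> aw\<close>, so the kernel is an
  automaton that reads words from right to left.  The automaton for \<open>f\<close> is its reversal: after the
  word \<open>u\<close> it remembers the values \<open>g(val u)\<close> for all \<open>g\<close> in the kernel.\<close>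

section \<open>Automata\<close>

text \<open>On \<open>X\<close> the map \<open>k\<close> factors through \<open>g\<close>, so its
  image is the image of a finite set. The finiteness proofs for actions, quotients and kernels below
  each exhibit such a finite invariant \<open>g\<close>.\<close>

lemma finite_image_factor:
  assumes "finite (g ` X)" and "\<And>x y. x \<in> X \<Longrightarrow> y \<in> X \<Longrightarrow> g x = g y \<Longrightarrow> k x = k y"
  shows "finite (k ` X)"
proof (rule finite_subset)
  show "k ` X \<subseteq> (\<lambda>b. k (inv_into X g b)) ` g ` X"
  proof
    fix c assume "c \<in> k ` X"
    then obtain x where x: "x \<in> X" "c = k x" by blast
    then have "k x = k (inv_into X g (g x))"
      by (intro assms(2)) (auto simp: inv_into_into f_inv_into_f)
    with x show "c \<in> (\<lambda>b. k (inv_into X g b)) ` g ` X" by blast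
  qed
qed (use assms(1) in blast)

lemma foldl_dtrans_in_states:
  assumes "finite_automaton A M" "q \<in> states M" "w \<in> lists A"
  shows "foldl (dtrans M) q w \<in> states M"
  using assms(3,2) by (induction w arbitrary: q) (use assms(1) in \<open>auto simp: finite_automaton_def\<close>)

lemma run_in_states:
  assumes "finite_automaton A M" "w \<in> lists A"
  shows "run M w \<in> states M"
  unfolding run_def using assms
  by (intro foldl_dtrans_in_states) (simp_all add: finite_automaton_def)

lemma run_append: "run M (u @ w) = foldl (dtrans M) (run M u) w"
  by (simp add: run_def)

text \<open>Appending \<open>w\<close> acts on the state \<open>run M u\<close> by a self-map of
  \<open>states M\<close>, and a finite set has only finitely many self-maps.
  \<open>restrict\<close> discards the values at words outside \<open>lists A\<close>, where the run
  may leave the state set.\<close>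

lemma finite_right_actions:
  fixes M :: "('q, 'a) det_automaton"
  assumes "finite_automaton A M"
  shows "finite ((\<lambda>w. restrict (\<lambda>u. run M (u @ w)) (lists A)) ` lists A)"
proof (rule finite_image_factor)
  have "(\<lambda>w. restrict (\<lambda>q. foldl (dtrans M) q w) (states M)) ` lists A
    \<subseteq> (\<Pi>\<^sub>E q\<in>states M. states M)"
    by (intro image_subsetI restrict_PiE_iff[THEN iffD2] ballI foldl_dtrans_in_states[OF assms])
  moreover have "finite (\<Pi>\<^sub>E q\<in>states M. states M)"
    using assms by (intro finite_PiE) (auto simp: finite_automaton_def)
  ultimately show "finite ((\<lambda>w. restrict (\<lambda>q. foldl (dtrans M) q w) (states M)) ` lists A)"
    by (rule finite_subset)
next
  fix w w' :: "'a list"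
  assume eq: "restrict (\<lambda>q. foldl (dtrans M) q w) (states M)
    = restrict (\<lambda>q. foldl (dtrans M) q w') (states M)"
  show "restrict (\<lambda>u. run M (u @ w)) (lists A) = restrict (\<lambda>u. run M (u @ w')) (lists A)"
  proof (rule restrict_ext)
    fix u assume "u \<in> lists A"
    then have "run M u \<in> states M" by (rule run_in_states[OF assms])
    then show "run M (u @ w) = run M (u @ w')"
      using fun_cong[OF eq, of "run M u"] by (simp add: run_append)
  qed
qed

text \<open>One half of a Myhill-Nerode theorem: the quotient by \<open>w\<close> depends only on
  how \<open>w\<close> acts on the states of an automaton for \<open>L\<close>. The word
  \<open>w\<close> ranges over all lists because it will be a component of a word over the product
  alphabet, which may contain \<open>h\<close>.\<close>

lemma finite_right_quotients:
  assumes "regular_language A L"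
  shows "finite (range (\<lambda>w. {u. u @ w \<in> L}))"
proof -
  obtain M :: "(nat, 'a) det_automaton" and F where
    M: "finite_automaton A M" and F: "\<And>w. w \<in> lists A \<Longrightarrow> w \<in> L \<longleftrightarrow> run M w \<in> F"
    and L: "L \<subseteq> lists A"
    using assms unfolding regular_language_def by blast
  have "finite ((\<lambda>w. {u. u @ w \<in> L}) ` lists A)"
  proof (rule finite_image_factor[OF finite_right_actions[OF M]])
    fix w w'
    assume w: "w \<in> lists A" "w' \<in> lists A"
      and eq: "restrict (\<lambda>u. run M (u @ w)) (lists A) = restrict (\<lambda>u. run M (u @ w')) (lists A)"
    have "u @ w \<in> L \<longleftrightarrow> u @ w' \<in> L" for u
    proof (cases "u \<in> lists A")
      case True
      then have "run M (u @ w) = run M (u @ w')" using fun_cong[OF eq, of u] by simp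
      moreover have "u @ w \<in> lists A" "u @ w' \<in> lists A" using True w by auto
      ultimately show ?thesis using F by simp
    next
      case False
      then show ?thesis using L by auto
    qed
    then show "{u. u @ w \<in> L} = {u. u @ w' \<in> L}" by blast
  qed
  \<comment> \<open>A word with a letter outside \<open>A\<close> ends no word of \<open>L\<close>,
    so it contributes only the empty quotient.\<close>
  moreover have "range (\<lambda>w. {u. u @ w \<in> L}) \<subseteq> insert {} ((\<lambda>w. {u. u @ w \<in> L}) ` lists A)"
  proof clarify
    fix w assume *: "{u. u @ w \<in> L} \<notin> (\<lambda>w. {u. u @ w \<in> L}) ` lists A"
    then have "w \<notin> lists A" by blast
    then show "{u. u @ w \<in> L} = {}" using L by auto
  qed
  ultimately show ?thesis by (meson finite_insert finite_subset)
qed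

text \<open>\<open>automatic\<close> demands natural numbers as states, whereas the automaton built
  from the kernel has functions as states. Numbering its finite state set injectively transfers it;
  \<open>d\<close> decodes a number into its state.\<close>

lemma finite_automaton_nat_states:
  fixes M :: "('q, 'a) det_automaton"
  assumes M: "finite_automaton A M"
  obtains M' :: "(nat, 'a) det_automaton" and d where
    "finite_automaton A M'" "\<And>w. w \<in> lists A \<Longrightarrow> d (run M' w) = run M w"
    "\<And>q. q \<in> states M' \<Longrightarrow> d q \<in> states M"
proof -
  have "finite (states M)" using M by (simp add: finite_automaton_def)
  then obtain e :: "'q \<Rightarrow> nat" where e: "inj_on e (states M)"
    using finite_imp_inj_to_nat_seg by blast
  define d where "d = inv_into (states M) e"
  have de: "d (e q) = q" if "q \<in> states M" for q
    using e that by (simp add: d_def)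
  define M' where "M' = \<lparr>states = e ` states M, initial = e (initial M),
    dtrans = \<lambda>q a. e (dtrans M (d q) a)\<rparr>"
  have fin: "finite_automaton A M'"
    using M de by (auto simp: finite_automaton_def M'_def)
  have "run M' w = e (run M w)" if "w \<in> lists A" for w
    using that
  proof (induction w rule: rev_induct)
    case Nil
    then show ?case by (simp add: run_def M'_def)
  next
    case (snoc a w)
    then have "run M w \<in> states M" using run_in_states[OF M] by simp
    with snoc show ?case by (simp add: run_append de) (simp add: M'_def de)
  qed
  then have "d (run M' w) = run M w" if "w \<in> lists A" for w
    using de run_in_states[OF M] that by simp
  moreover have "d q \<in> states M" if "q \<in> states M'" for q
    using that de by (auto simp: M'_def)
  ultimately show ?thesis using that fin by blast
qed

section \<open>Enumeration in radix order\<close>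

text \<open>The rank grows strictly along \<open>R\<close>, hence is injective. Its range is
  downward closed, because the predecessors of \<open>w\<close> fill all values below the rank of
  \<open>w\<close>, and unbounded, because \<open>L\<close> is infinite.\<close>

lemma bij_betw_rank:
  assumes tr: "trans R" and irr: "irrefl R" and tot: "total_on L R"
    and fin: "\<And>w. w \<in> L \<Longrightarrow> finite {u \<in> L. (u, w) \<in> R}" and inf: "infinite L"
  shows "bij_betw (\<lambda>w. card {u \<in> L. (u, w) \<in> R}) L (UNIV :: nat set)"
proof -
  let ?seg = "\<lambda>w. {u \<in> L. (u, w) \<in> R}" and ?rank = "\<lambda>w. card {u \<in> L. (u, w) \<in> R}"
  have less: "?rank u < ?rank w" if "u \<in> L" "w \<in> L" "(u, w) \<in> R" for u w
  proof (rule psubset_card_mono[OF fin[OF that(2)]])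
    have "?seg u \<subseteq> ?seg w" using transD[OF tr _ that(3)] by blast
    moreover have "u \<in> ?seg w - ?seg u" using that irr by (simp add: irrefl_def)
    ultimately show "?seg u \<subset> ?seg w" by blast
  qed
  have inj: "inj_on ?rank L"
  proof (rule inj_onI, rule ccontr)
    fix u w assume uw: "u \<in> L" "w \<in> L" "?rank u = ?rank w" "u \<noteq> w"
    then have "(u, w) \<in> R \<or> (w, u) \<in> R" using tot by (simp add: total_on_def)
    then show False using less[OF uw(1,2)] less[OF uw(2,1)] uw(3) by linarith
  qed
  \<comment> \<open>By injectivity the image has as many elements as \<open>?seg w\<close>, which is
    \<open>?rank w\<close>; an inclusion of finite sets of equal size is an equality.\<close>
  have image: "?rank ` ?seg w = {..<?rank w}" if "w \<in> L" for w
  proof (rule card_subset_eq)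
    show "?rank ` ?seg w \<subseteq> {..<?rank w}"
    proof (rule image_subsetI)
      fix u assume "u \<in> ?seg w"
      then have "u \<in> L" "(u, w) \<in> R" by simp_all
      then show "?rank u \<in> {..<?rank w}" using less[OF _ that] by (intro lessThan_iff[THEN iffD2])
    qed
    have "inj_on ?rank (?seg w)" using inj by (rule inj_on_subset) auto
    then show "card (?rank ` ?seg w) = card {..<?rank w}" by (simp add: card_image)
  qed simp
  have "n \<in> ?rank ` L" for n
  proof -
    have "infinite (?rank ` L)" using inf inj by (simp add: finite_image_iff)
    then obtain w where "w \<in> L" "n < ?rank w"
      unfolding finite_nat_set_iff_bounded_le by (auto simp: not_le)
    then show ?thesis using image[of w] by blast
  qed
  then show ?thesis using inj by (auto simp: bij_betw_def)
qed

lemma total_on_lenlex: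
  assumes "total_on A r"
  shows "total_on (lists A) (lenlex r)"
proof -
  have "(u, w) \<in> lenlex r \<or> (w, u) \<in> lenlex r"
    if "u \<in> lists A" "w \<in> lists A" "u \<noteq> w" for u w
    using that
  proof (induction u arbitrary: w rule: lists.induct)
    case Nil
    then show ?case by simp
  next
    case (Cons a u)
    show ?case
    proof (cases w)
      case Nil
      then show ?thesis by simp
    next
      case [simp]: (Cons b w')
      have "(a, b) \<in> r \<or> (b, a) \<in> r \<or> a = b"
        using assms Cons.hyps(1) Cons.prems by (auto simp: total_on_def)
      moreover have "(u, w') \<in> lenlex r \<or> (w', u) \<in> lenlex r" if "u \<noteq> w'"
        using Cons.IH[of w'] Cons.prems that by simp
      ultimately show ?thesis
        using Cons.prems unfolding \<open>w = b # w'\<close> Cons_lenlex_iff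
        by (metis linorder_neqE_nat)
    qed
  qed
  then show ?thesis by (simp add: total_on_def)
qed

text \<open>\<open>rep\<close> inverts the rank function of the radix order. Initial segments are
  finite because a predecessor of \<open>w\<close> is no longer than \<open>w\<close> and the
  alphabet is finite.\<close>

lemma bij_betw_rep:
  assumes S: "abstract_numeration_system S"
  shows "bij_betw (rep S) UNIV (language S)"
proof -
  let ?R = "lenlex (letter_less S)"
  let ?rank = "\<lambda>w. card {u \<in> language S. (u, w) \<in> ?R}"
  have fA: "finite (alphabet S)" and r: "strict_linear_order_on (alphabet S) (letter_less S)"
    and L: "language S \<subseteq> lists (alphabet S)" and inf: "infinite (language S)"
    using S by (auto simp: abstract_numeration_system_def regular_language_def)
  have "finite {u \<in> language S. (u, w) \<in> ?R}" for w
  proof (rule finite_subset[OF _ finite_lists_length_le[OF fA]])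
    show "{u \<in> language S. (u, w) \<in> ?R} \<subseteq> {xs. set xs \<subseteq> alphabet S \<and> length xs \<le> length w}"
      using L by (auto dest: lenlex_length)
  qed
  moreover have "total_on (language S) ?R"
    using r L by (meson strict_linear_order_on_def total_on_lenlex total_on_subset)
  ultimately have bij: "bij_betw ?rank (language S) UNIV"
    using r inf by (intro bij_betw_rank)
      (auto simp: strict_linear_order_on_def lenlex_transI lenlex_irreflexive irrefl_def)
  \<comment> \<open>The definite description in \<open>rep\<close> is the one that defines
    \<open>the_inv_into\<close>.\<close>
  have "rep S n = the_inv_into (language S) ?rank n" for n
    by (simp add: rep_def the_inv_into_def)
  then show ?thesis using bij_betw_the_inv_into[OF bij] by presburger
qed

section \<open>Padding\<close>

text \<open>The language h*L. The length of the padding is left free; it is determined only when all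
  components are read in parallel.\<close>

definition padded_language :: "'a \<Rightarrow> 'a list set \<Rightarrow> 'a list set" where
  "padded_language h L = {replicate k h @ x | k x. x \<in> L}"

lemma replicate_in_padded_language: "x \<in> L \<Longrightarrow> replicate k h @ x \<in> padded_language h L"
  by (auto simp: padded_language_def)

text \<open>The cut between \<open>u\<close> and \<open>w\<close> falls either in the padding or in
  the word that follows it. Hence \<open>w\<close> matters only through its own membership and
  through its right quotient of \<open>L\<close>.\<close>

lemma append_in_padded_language_iff:
  "u @ w \<in> padded_language h L \<longleftrightarrow>
     (\<exists>k. u = replicate k h) \<and> w \<in> padded_language h L \<or>
     (\<exists>k x. u = replicate k h @ x \<and> x @ w \<in> L)" (is "?l \<longleftrightarrow> ?r")
proof
  assume ?l
  then obtain k y where y: "y \<in> L" "u @ w = replicate k h @ y"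
    by (auto simp: padded_language_def)
  then consider us where "u @ us = replicate k h" "w = us @ y"
    | us where "u = replicate k h @ us" "us @ w = y"
    by (auto simp: append_eq_append_conv2)
  then show ?r
  proof cases
    case 1
    then have "u = replicate (length u) h" "us = replicate (length us) h"
      by (metis append_eq_append_conv length_append length_replicate replicate_add)+
    with 1 y show ?thesis unfolding padded_language_def by blast
  next
    case 2
    with y show ?thesis by blast
  qed
next
  assume ?r
  then show ?l
  proof (elim disjE conjE exE)
    fix k assume u: "u = replicate k h" and "w \<in> padded_language h L"
    then obtain j x where "w = replicate j h @ x" "x \<in> L" by (auto simp: padded_language_def)
    with u show ?l by (simp add: replicate_in_padded_language flip: append_assoc replicate_add)
  next
    fix k x assume "u = replicate k h @ x" "x @ w \<in> L"
    then show ?l by (simp add: replicate_in_padded_language)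
  qed
qed

text \<open>A prefix that ends within the padding is the padded empty word, and the empty word lies
  in every nonempty prefix-closed language.\<close>

lemma prefix_closed_padded_language:
  assumes "prefix_closed L" "L \<noteq> {}"
  shows "prefix_closed (padded_language h L)"
proof -
  have Nil: "[] \<in> L" using assms by (auto simp: prefix_closed_def)
  have "u \<in> padded_language h L" if "u @ w \<in> padded_language h L" for u w
    using that unfolding append_in_padded_language_iff
  proof (elim disjE conjE exE)
    fix k assume "u = replicate k h"
    then show ?thesis using replicate_in_padded_language[OF Nil, of k h] by simp
  next
    fix k x assume u: "u = replicate k h @ x" and "x @ w \<in> L"
    then have "x \<in> L" using assms(1) by (auto simp: prefix_closed_def)
    with u show ?thesis by (simp add: replicate_in_padded_language)
  qed
  then show ?thesis by (auto simp: prefix_closed_def prefix_def)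
qed

text \<open>By the case split on the cut, the quotient is determined by a quotient of
  \<open>L\<close>, of which there are finitely many, and one truth value.\<close>

lemma finite_right_quotients_padded_language:
  assumes "regular_language A L"
  shows "finite (range (\<lambda>w. {u. u @ w \<in> padded_language h L}))"
proof (rule finite_image_factor)
  have "range (\<lambda>w. ({u. u @ w \<in> L}, w \<in> padded_language h L)) \<subseteq> range (\<lambda>w. {u. u @ w \<in> L}) \<times> UNIV"
    by auto
  then show "finite (range (\<lambda>w. ({u. u @ w \<in> L}, w \<in> padded_language h L)))"
    by (rule finite_subset) (simp add: finite_right_quotients[OF assms])
next
  fix w w'
  assume "({u. u @ w \<in> L}, w \<in> padded_language h L) = ({u. u @ w' \<in> L}, w' \<in> padded_language h L)"
  then show "{u. u @ w \<in> padded_language h L} = {u. u @ w' \<in> padded_language h L}"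
    unfolding append_in_padded_language_iff by auto
qed

section \<open>Components of padded tuples\<close>

abbreviation component :: "'d \<Rightarrow> ('d \<Rightarrow> 'a) list \<Rightarrow> 'a list" where
  "component i v \<equiv> map (\<lambda>a. a i) v"

lemma list_eq_componentsI:
  assumes "length u = length v" "\<And>i. component i u = component i v"
  shows "u = v"
proof (rule nth_equalityI[OF assms(1)], rule ext)
  fix j i assume "j < length u"
  then show "(u ! j) i = (v ! j) i"
    using arg_cong[OF assms(2)[of i], of "\<lambda>l. l ! j"] assms(1) by simp
qed

lemma length_padded_words:
  "length (padded_words h ws) = Max (range (\<lambda>i. length (ws i)))"
  by (simp add: padded_words_def Let_def)

lemma length_le_padded_words: "length (ws i) \<le> length (padded_words h ws)"
  for ws :: "'d::finite \<Rightarrow> 'a list"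
  by (simp add: length_padded_words)

lemma component_padded_words:
  fixes ws :: "'d::finite \<Rightarrow> 'a list"
  shows "component i (padded_words h ws)
    = replicate (length (padded_words h ws) - length (ws i)) h @ ws i"
proof -
  let ?m = "length (padded_words h ws)"
  let ?u = "replicate (?m - length (ws i)) h @ ws i"
  have "length ?u = ?m" using length_le_padded_words[of ws i h] by simp
  then have "?u = map ((!) ?u) [0..<?m]" by (metis map_nth)
  also have "\<dots> = component i (padded_words h ws)"
    unfolding length_padded_words by (simp add: padded_words_def Let_def)
  finally show ?thesis ..
qed

section \<open>The product language and its enumeration\<close>

locale numeration_tuple =
  fixes S :: "'d::finite \<Rightarrow> 'a numeration" and h :: 'a
  assumes numeration: "abstract_numeration_system (S i)" and h_notin: "h \<notin> alphabet (S i)"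
begin

abbreviation "A \<equiv> product_alphabet h S"
abbreviation "L \<equiv> product_language h S"
abbreviation "rep\<^sub>S \<equiv> product_rep h S"
abbreviation "val\<^sub>S \<equiv> product_val h S"

lemma regular: "regular_language (alphabet (S i)) (language (S i))"
  using numeration by (simp add: abstract_numeration_system_def)

lemma language_subset: "w \<in> language (S i) \<Longrightarrow> w \<in> lists (alphabet (S i))"
  using regular[of i] unfolding regular_language_def by blast

lemma padded_words_in_lists:
  assumes ws: "\<And>i. ws i \<in> language (S i)"
  shows "padded_words h ws \<in> lists A"
proof -
  let ?v = "padded_words h ws"
  have "?v ! j \<in> A" if j: "j < length ?v" for j
  proof -
    have nth: "(?v ! j) i = (replicate (length ?v - length (ws i)) h @ ws i) ! j" for i
      using j by (simp flip: component_padded_words)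
    have "(?v ! j) i \<in> alphabet (S i) \<union> {h}" for i
    proof -
      have "(?v ! j) i \<in> set (component i ?v)" using j by auto
      then show ?thesis
        unfolding component_padded_words using language_subset[OF ws, of i] by auto
    qed
    moreover have "?v ! j \<noteq> (\<lambda>_. h)"
    \<comment> \<open>A word of maximal length receives no padding, so it puts a letter other than
      \<open>h\<close> into every column.\<close>
    proof -
      have "length ?v \<in> range (\<lambda>i. length (ws i))"
        unfolding length_padded_words by (rule Max_in) auto
      then obtain i where i: "length ?v = length (ws i)" by blast
      then have "(?v ! j) i \<in> set (ws i)" using nth[of i] j by simp
      then show ?thesis using language_subset[OF ws, of i] h_notin[of i] by auto
    qed
    ultimately show ?thesis by (simp add: product_alphabet_def)
  qed
  then show ?thesis by (auto simp: in_set_conv_nth)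
qed

lemma L_subset: "L \<subseteq> lists A"
  using padded_words_in_lists by (auto simp: product_language_def)

text \<open>Since the all-\<open>h\<close> letter is excluded, the first letter of a nonempty
  \<open>v\<close> differs from \<open>h\<close> in some component, which is then unpadded. So
  \<open>length v\<close> is the maximal length of the stripped words, and the paddings have exactly
  the lengths that \<open>padded_words\<close> gives them.\<close>

lemma in_L_iff:
  assumes v: "v \<in> lists A"
  shows "v \<in> L \<longleftrightarrow> (\<forall>i. component i v \<in> padded_language h (language (S i)))"
proof
  assume "v \<in> L"
  then show "\<forall>i. component i v \<in> padded_language h (language (S i))"
    by (auto simp: product_language_def component_padded_words replicate_in_padded_language)
next
  assume "\<forall>i. component i v \<in> padded_language h (language (S i))"
  then have "\<forall>i. \<exists>k x. component i v = replicate k h @ x \<and> x \<in> language (S i)"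
    by (simp add: padded_language_def)
  then obtain k ws where ws: "\<And>i. ws i \<in> language (S i)"
    and comp: "\<And>i. component i v = replicate (k i) h @ ws i"
    unfolding choice_iff by blast
  have len: "length v = k i + length (ws i)" for i
    using arg_cong[OF comp[of i], of length] by simp
  have "\<exists>i. k i = 0"
  proof (cases v)
    case Nil
    then show ?thesis using len by simp
  next
    case (Cons a v')
    then have "a \<noteq> (\<lambda>_. h)" using v by (simp add: product_alphabet_def)
    then obtain i where "a i \<noteq> h" by auto
    then have "k i = 0" using comp[of i] Cons by (cases "k i") auto
    then show ?thesis ..
  qed
  then have "length (padded_words h ws) = length v"
    unfolding length_padded_words
  proof (intro Max_eqI)
    show "y \<le> length v" if "y \<in> range (\<lambda>i. length (ws i))" for y
      using that len by (metis imageE le_add2)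
    show "length v \<in> range (\<lambda>i. length (ws i))"
      using \<open>\<exists>i. k i = 0\<close> len by (metis add_0 rangeI)
  qed simp
  moreover have "k i = length v - length (ws i)" for i by (simp add: len[of i])
  ultimately have "v = padded_words h ws"
    using comp by (intro list_eq_componentsI) (simp_all add: component_padded_words)
  then show "v \<in> L" using ws by (auto simp: product_language_def)
qed

text \<open>As \<open>h\<close> occurs in no word of the component languages, deleting the leading
  \<open>h\<close>s of a component recovers the representation of that coordinate.\<close>

lemma inj_product_rep: "inj rep\<^sub>S"
proof (rule injI, rule ext)
  fix m n i assume eq: "rep\<^sub>S m = rep\<^sub>S n"
  have rep: "rep (S i) k \<in> language (S i)" for k
    using bij_betw_rep[OF numeration[of i]] by (auto simp: bij_betw_def)
  have strip: "dropWhile (\<lambda>x. x = h) (component i (rep\<^sub>S k)) = rep (S i) (k i)" for k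
  proof -
    have "dropWhile (\<lambda>x. x = h) (rep (S i) (k i)) = rep (S i) (k i)"
      using language_subset[OF rep[of "k i"]] h_notin[of i] by (cases "rep (S i) (k i)") auto
    then show ?thesis
      unfolding product_rep_def component_padded_words by (subst dropWhile_append2) auto
  qed
  have "rep (S i) (m i) = rep (S i) (n i)" using strip[of m] strip[of n] eq by simp
  then show "m i = n i"
    using bij_betw_rep[OF numeration[of i]] by (auto simp: bij_betw_def dest: injD)
qed

lemma range_product_rep: "range rep\<^sub>S = L"
proof (intro equalityI subsetI)
  have range: "range (rep (S i)) = language (S i)" for i
    using bij_betw_rep[OF numeration[of i]] by (simp add: bij_betw_def)
  {
    fix v assume "v \<in> range rep\<^sub>S"
    then show "v \<in> L"
      using range unfolding product_rep_def product_language_def by blast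
  next
    fix v assume "v \<in> L"
    then obtain ws where ws: "v = padded_words h ws" "\<And>i. ws i \<in> range (rep (S i))"
      unfolding range by (auto simp: product_language_def)
    then obtain n where "\<And>i. ws i = rep (S i) (n i)" unfolding image_iff by metis
    then have "ws = (\<lambda>i. rep (S i) (n i))" by blast
    with ws have "v = rep\<^sub>S n" by (simp add: product_rep_def)
    then show "v \<in> range rep\<^sub>S" by blast
  }
qed

lemma product_rep_in_L: "rep\<^sub>S n \<in> L"
  using range_product_rep by blast

lemma product_rep_in_lists: "rep\<^sub>S n \<in> lists A"
  using product_rep_in_L L_subset by blast

lemma product_val_rep [simp]: "val\<^sub>S (rep\<^sub>S n) = n"
  using inj_product_rep by (simp add: product_val_def)

lemma product_rep_val: "v \<in> L \<Longrightarrow> rep\<^sub>S (val\<^sub>S v) = v"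
  using range_product_rep by (simp add: product_val_def f_inv_into_f)

section \<open>Kernels and automata\<close>

text \<open>The pair of \<open>quot w\<close> and \<open>act w\<close> is the finite invariant:
  \<open>quot w\<close> decides whether appending \<open>w\<close> to \<open>rep\<^sub>S n\<close>
  stays in \<open>L\<close>, and \<open>act w\<close> gives the state reached, hence the value of
  \<open>f\<close>.\<close>

lemma automatic_imp_finite_kernel:
  fixes f :: "('d \<Rightarrow> nat) \<Rightarrow> 'k::zero"
  assumes "automatic h S f"
  shows "finite (numeration_kernel h S f)"
proof -
  obtain M :: "(nat, 'd \<Rightarrow> 'a) det_automaton" and \<tau>
    where M: "finite_automaton A M" and f: "\<And>n. f n = \<tau> (run M (rep\<^sub>S n))"
    using assms unfolding automatic_def by blast
  define quot where "quot w i = {u. u @ component i w \<in> padded_language h (language (S i))}"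
    for w i
  define act where "act w = restrict (\<lambda>u. run M (u @ w)) (lists A)" for w
  have kernel_elem: "kernel_elem h S f w n =
    (if \<forall>i. component i (rep\<^sub>S n) \<in> quot w i then \<tau> (act w (rep\<^sub>S n)) else 0)"
    if w: "w \<in> lists A" for w n
  proof -
    have v: "rep\<^sub>S n @ w \<in> lists A" using w product_rep_in_lists[of n] by auto
    have "rep\<^sub>S n @ w \<in> L \<longleftrightarrow> (\<forall>i. component i (rep\<^sub>S n) \<in> quot w i)"
      unfolding in_L_iff[OF v] quot_def by simp
    moreover have "f (val\<^sub>S (rep\<^sub>S n @ w)) = \<tau> (act w (rep\<^sub>S n))" if "rep\<^sub>S n @ w \<in> L"
      using product_rep_in_lists[of n] unfolding f product_rep_val[OF that] act_def by simp
    ultimately show ?thesis by (simp add: kernel_elem_def)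
  qed
  \<comment> \<open>Each component has finitely many quotients and the index type is finite, so
    there are finitely many families of quotients.\<close>
  have "quot ` lists A \<subseteq> (\<Pi>\<^sub>E i\<in>UNIV. range (\<lambda>w. {u. u @ w \<in> padded_language h (language (S i))}))"
    by (auto simp: quot_def)
  moreover have "finite (\<Pi>\<^sub>E i\<in>UNIV. range (\<lambda>w. {u. u @ w \<in> padded_language h (language (S i))}))"
    using finite_right_quotients_padded_language[OF regular] by (intro finite_PiE) auto
  ultimately have "finite (quot ` lists A)" by (rule finite_subset)
  moreover have "finite (act ` lists A)"
    using finite_right_actions[OF M] unfolding act_def .
  ultimately have "finite ((\<lambda>w. (quot w, act w)) ` lists A)"
    by (rule finite_subset[OF _ finite_cartesian_product, rotated]) auto
  then show ?thesis
    unfolding numeration_kernel_def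
  proof (rule finite_image_factor[where g = "\<lambda>w. (quot w, act w)"])
    fix w w'
    assume w: "w \<in> lists A" "w' \<in> lists A" and "(quot w, act w) = (quot w', act w')"
    then have eq: "quot w = quot w'" "act w = act w'" by blast+
    show "kernel_elem h S f w = kernel_elem h S f w'"
      by (rule ext) (simp only: kernel_elem[OF w(1)] kernel_elem[OF w(2)] eq)
  qed
qed

section \<open>From a finite kernel to an automaton\<close>

lemma prefix_closed_L:
  assumes "\<And>i. prefix_closed (language (S i))"
  shows "prefix_closed L"
  unfolding prefix_closed_def
proof (intro ballI allI impI)
  fix v u assume v: "v \<in> L" and "prefix u v"
  then obtain w where w: "v = u @ w" by (auto simp: prefix_def)
  have vA: "v \<in> lists A" using v L_subset by blast
  then have uA: "u \<in> lists A" using w by auto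
  have "component i u \<in> padded_language h (language (S i))" for i
  proof -
    have "language (S i) \<noteq> {}"
      using numeration[of i] by (auto simp: abstract_numeration_system_def)
    then have "prefix_closed (padded_language h (language (S i)))"
      by (rule prefix_closed_padded_language[OF assms])
    moreover have "component i v \<in> padded_language h (language (S i))"
      using v in_L_iff[OF vA] by blast
    ultimately show ?thesis unfolding prefix_closed_def w by auto
  qed
  then show "u \<in> L" using in_L_iff[OF uA] by blast
qed

lemma kernel_elem_Nil: "kernel_elem h S f [] = f"
  by (simp add: fun_eq_iff kernel_elem_def product_rep_in_L)

text \<open>The left side is 0 as soon as \<open>rep\<^sub>S n @ [a]\<close> leaves
  \<open>L\<close>. Prefix-closedness ensures that \<open>rep\<^sub>S n @ a # w\<close> is then
  outside \<open>L\<close> too, so both sides use the default value together.\<close>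

lemma kernel_elem_Cons:
  assumes "prefix_closed L"
  shows "kernel_elem h S (kernel_elem h S f w) [a] = kernel_elem h S f (a # w)"
proof
  fix n
  have "rep\<^sub>S n @ [a] \<in> L" if "rep\<^sub>S n @ a # w \<in> L"
    using assms that by (auto simp: prefix_closed_def)
  then show "kernel_elem h S (kernel_elem h S f w) [a] n = kernel_elem h S f (a # w) n"
    by (auto simp: kernel_elem_def product_rep_val)
qed

text \<open>A state is a table of values in \<Delta> indexed by the kernel. The value of
  \<open>g\<close> after one more letter \<open>a\<close> is the value of
  \<open>kernel_elem h S g [a]\<close> before it, so the table can be updated letter by
  letter.\<close>

lemma finite_kernel_imp_automatic:
  fixes f :: "('d \<Rightarrow> nat) \<Rightarrow> 'k::zero"
  assumes pc: "prefix_closed L" and fin: "finite (numeration_kernel h S f)"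
  shows "automatic h S f"
proof -
  let ?K = "numeration_kernel h S f"
  have L_prefix: "u \<in> L" if "u @ w \<in> L" for u w
    using pc that by (auto simp: prefix_closed_def)
  have NilL: "[] \<in> L" using L_prefix[of "[]"] product_rep_in_L by (metis append_Nil)
  have fK: "f \<in> ?K"
    unfolding numeration_kernel_def using kernel_elem_Nil[of f] by (metis imageI lists.Nil)
  have K_step: "kernel_elem h S g [a] \<in> ?K" if "g \<in> ?K" "a \<in> A" for g a
  proof -
    obtain w where w: "w \<in> lists A" "g = kernel_elem h S f w"
      using \<open>g \<in> ?K\<close> by (auto simp: numeration_kernel_def)
    then have "kernel_elem h S g [a] = kernel_elem h S f (a # w)" by (simp add: kernel_elem_Cons[OF pc])
    then show ?thesis
      unfolding numeration_kernel_def using w(1) \<open>a \<in> A\<close> by (metis imageI lists.Cons)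
  qed
  \<comment> \<open>The value \<open>f n\<close> is the value of
    \<open>kernel_elem h S f (rep\<^sub>S n)\<close> at the tuple represented by the empty word, so
    a finite kernel forces a finite range of \<open>f\<close>. The 0 accounts for the default value
    in \<open>kernel_elem\<close>.\<close>
  define \<Delta> where "\<Delta> = insert 0 ((\<lambda>g. g (val\<^sub>S [])) ` ?K)"
  have f_range: "f n \<in> \<Delta>" for n
  proof -
    have "kernel_elem h S f (rep\<^sub>S n) (val\<^sub>S []) = f n"
      by (simp add: kernel_elem_def product_rep_val[OF NilL] product_rep_in_L)
    moreover have "kernel_elem h S f (rep\<^sub>S n) \<in> ?K"
      using product_rep_in_lists by (auto simp: numeration_kernel_def)
    ultimately show ?thesis unfolding \<Delta>_def by (metis imageI insertI2)
  qed
  have K_range: "g n \<in> \<Delta>" if "g \<in> ?K" for g n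
  proof -
    have "0 \<in> \<Delta>" by (simp add: \<Delta>_def)
    with that f_range show ?thesis unfolding numeration_kernel_def
      by (auto simp: kernel_elem_def)
  qed
  \<comment> \<open>The initial table holds the values at the empty word; a transition looks up the
    entry of the shifted kernel element.\<close>
  define M where "M = \<lparr>states = (\<Pi>\<^sub>E g\<in>?K. \<Delta>), initial = restrict (\<lambda>g. g (val\<^sub>S [])) ?K,
    dtrans = \<lambda>\<sigma> a. restrict (\<lambda>g. \<sigma> (kernel_elem h S g [a])) ?K\<rparr>"
  have fin\<Delta>: "finite \<Delta>" using fin by (simp add: \<Delta>_def)
  have M: "finite_automaton A M"
    unfolding finite_automaton_def
  proof (intro conjI ballI)
    show "finite (states M)" using fin fin\<Delta> by (simp add: M_def finite_PiE)
    show "initial M \<in> states M" using K_range by (simp add: M_def)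
    show "dtrans M \<sigma> a \<in> states M" if "\<sigma> \<in> states M" "a \<in> A" for \<sigma> a
      using that K_step by (auto simp: M_def)
  qed
  \<comment> \<open>The invariant is claimed on \<open>L\<close> only; prefix-closedness keeps the
    induction on prefixes inside \<open>L\<close>.\<close>
  have run: "run M u = restrict (\<lambda>g. g (val\<^sub>S u)) ?K" if "u \<in> L" for u
    using that
  proof (induction u rule: rev_induct)
    case Nil
    then show ?case by (simp add: run_def M_def)
  next
    case (snoc a u)
    then have u: "u \<in> L" and a: "a \<in> A" using L_prefix L_subset by auto
    have "kernel_elem h S g [a] (val\<^sub>S u) = g (val\<^sub>S (u @ [a]))" for g :: "('d \<Rightarrow> nat) \<Rightarrow> 'k"
      using snoc.prems by (simp add: kernel_elem_def product_rep_val[OF u])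
    then show ?case
      using snoc.IH[OF u] K_step[OF _ a] by (simp add: run_append) (simp add: M_def cong: restrict_cong)
  qed
  obtain M' :: "(nat, 'd \<Rightarrow> 'a) det_automaton" and d where
    M': "finite_automaton A M'" "\<And>w. w \<in> lists A \<Longrightarrow> d (run M' w) = run M w"
      "\<And>q. q \<in> states M' \<Longrightarrow> d q \<in> states M"
    using finite_automaton_nat_states[OF M] by blast
  show ?thesis
    unfolding automatic_def
  proof (intro exI conjI ballI allI)
    show "finite_automaton A M'" "finite \<Delta>" by fact+
    \<comment> \<open>The output of a state is its table entry at \<open>f\<close>, which belongs to
      the kernel as the element for the empty word.\<close>
    show "d q f \<in> \<Delta>" if "q \<in> states M'" for q
      using M'(3)[OF that] fK by (auto simp: M_def)
    show "f n = d (run M' (rep\<^sub>S n)) f" for n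
      using fK by (simp add: M'(2)[OF product_rep_in_lists] run[OF product_rep_in_L])
  qed
qed

end

theorem theorem6p4:
  fixes S :: "'d::finite \<Rightarrow> 'a numeration"
    and h :: 'a
    and f :: "('d \<Rightarrow> nat) \<Rightarrow> 'k::semiring_0"
  assumes "\<And>i. abstract_numeration_system (S i)"
    and "\<And>i. h \<notin> alphabet (S i)"
  shows "(automatic h S f \<longrightarrow> finite (numeration_kernel h S f)) \<and>
         ((\<forall>i. prefix_closed (language (S i))) \<and> finite (numeration_kernel h S f) \<longrightarrow> automatic h S f)"
proof -
  interpret numeration_tuple S h by unfold_locales (fact assms)+
  show ?thesis
    using automatic_imp_finite_kernel finite_kernel_imp_automatic prefix_closed_L by blast
qed

end
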